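(* Assume $q_i>0$ for all $i\in\mathbb{N}$ and $\mathbb{E} Z=\infty$. Then, with probability one, $L_n\to-\infty$ as $n\to\infty$.
   Context: Let $Z,W,(Z_n)_{n\ge1},(W_n)_{n\ge1}$ be independent, identically distributed random variables taking values in $\mathbb{N}=\{1,2,3,\dots\}$, and let $q_i=\mathbb{P}(Z=i)$. Define sets $T_n\subset\mathbb{Z}$ recursively by $T_n=\{n\}$ for $n\le 0$ and $T_n=\{n\}\cup T_{n-Z_n}\cup T_{n-W_n}$ for $n\ge1$. Let $\mathcal{L}_n=T_n\cap\{0,-1,-2,\dots\}$ and $L_n=\min\mathcal{L}_n$. *)

theory Defs
  imports "HOL-Probability.Probability"
begin

text \<open>The random sets T_n for a fixed realisation z = (Z_n), w = (W_n) of the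
  step sizes. Z_n, W_n take values in {1,2,...}; the guard on value 0 only
  ensures termination and is irrelevant almost surely.\<close>

function Tset :: "(nat \<Rightarrow> nat) \<Rightarrow> (nat \<Rightarrow> nat) \<Rightarrow> int \<Rightarrow> int set" where
  "Tset z w n =
     (if n \<le> 0 \<or> z (nat n) = 0 \<or> w (nat n) = 0 then {n}
      else {n} \<union> Tset z w (n - int (z (nat n))) \<union> Tset z w (n - int (w (nat n))))"
  by pat_completeness auto
termination
  by (relation "Wellfounded.measure (\<lambda>(z, w, n). nat n)") auto

definition Lset :: "(nat \<Rightarrow> nat) \<Rightarrow> (nat \<Rightarrow> nat) \<Rightarrow> int \<Rightarrow> int set" where
  "Lset z w n = Tset z w n \<inter> {..0}"

definition Lmin :: "(nat \<Rightarrow> nat) \<Rightarrow> (nat \<Rightarrow> nat) \<Rightarrow> int \<Rightarrow> int" where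
  "Lmin z w n = Min (Lset z w n)"

end

theory Submission
  imports Defs
begin

text \<open>
  Fix a level a \<le> 0 and let B be the random set of sites m with T_m contained in {t. a < t}.
  Let P_n be the q-measure of {i. n - i \<in> B}. Given the sites below n, the site n \<ge> 1 joins B with
  probability P_n^2. Since every site b contributes to the sum of the P_n at most the total mass of q,
  the sum of P_1, ..., P_N is at most |a| plus the number of elements of B in {1..N}. Taking
  expectations bounds E (\<Sum>n. P_n (1 - P_n)) by |a|, so the series converges almost surely and P_n is
  eventually close to 0 or to 1. It cannot jump from near 0 to near 1: P_n < q_1 forces
  n - 1 \<notin> B, hence P_(n+1) \<le> 1 - q_2. It cannot stay near 1 either, as 1 - P_n is at least the
  probability of {i. i \<ge> n - a}, which is not summable because the mean of q is infinite.
  So P_n is eventually small, and the Borel-Cantelli lemma shows that only finitely many n belong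
  to B while P_n is bounded away from 1.
\<close>

section \<open>Sites whose tree stays above a level: recursion, locality and measurability\<close>

declare Tset.simps [simp del]

definition avoids :: "int \<Rightarrow> (nat \<Rightarrow> nat) \<Rightarrow> (nat \<Rightarrow> nat) \<Rightarrow> int \<Rightarrow> bool" where
  "avoids a z w n \<longleftrightarrow> (\<forall>t \<in> Tset z w n. a < t)"

definition past :: "int \<Rightarrow> (nat \<Rightarrow> nat) \<Rightarrow> (nat \<Rightarrow> nat) \<Rightarrow> int \<Rightarrow> int set" where
  "past a z w n = {m. m < n \<and> avoids a z w m}"

text \<open>With \<open>S\<close> the set \<open>B\<close> below \<open>n\<close>, this is the
  \<open>P_n\<close> of the outline. Keeping \<open>S\<close> as an explicit argument allows
  conditioning on the past by a finite sum over its values.\<close>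

definition hit :: "nat pmf \<Rightarrow> int \<Rightarrow> int set \<Rightarrow> real" where
  "hit q n S = measure_pmf.prob q {i. n - int i \<in> S}"

lemma avoids_nonpos: "n \<le> 0 \<Longrightarrow> avoids a z w n \<longleftrightarrow> a < n"
  by (simp add: avoids_def Tset.simps[of z w n])

lemma avoids_greater: "avoids a z w n \<Longrightarrow> a < n"
  unfolding avoids_def by (subst (asm) Tset.simps) (auto split: if_splits)

lemma avoids_pos:
  assumes "a \<le> 0" "n \<ge> 1"
  shows "avoids a z w n \<longleftrightarrow> z (nat n) = 0 \<or> w (nat n) = 0 \<or>
    avoids a z w (n - int (z (nat n))) \<and> avoids a z w (n - int (w (nat n)))"
  unfolding avoids_def using assms by (subst Tset.simps) auto

lemma finite_Tset: "finite (Tset z w n)"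
proof (induction z w n rule: Tset.induct)
  case (1 z w n)
  then show ?case by (subst Tset.simps) auto
qed

text \<open>Every step is at least 1, so following the \<open>z\<close> branch downwards must leave
  the positive sites. Hence \<open>Lset\<close> is nonempty and \<open>Lmin\<close> is a genuine
  minimum.\<close>

lemma Tset_meets_nonpos:
  assumes "\<And>k. z k > 0" "\<And>k. w k > 0"
  shows "\<exists>t \<in> Tset z w n. t \<le> 0"
  using assms
proof (induction z w n rule: Tset.induct)
  case (1 z w n)
  show ?case
  proof (cases "n \<le> 0")
    case True
    then show ?thesis by (simp add: Tset.simps[of z w n])
  next
    case False
    then have step: "\<not> (n \<le> 0 \<or> z (nat n) = 0 \<or> w (nat n) = 0)"
      using 1(3)[of "nat n"] 1(4)[of "nat n"] by simp
    obtain t where "t \<in> Tset z w (n - int (z (nat n)))" "t \<le> 0"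
      using 1(1)[OF step 1(3,4)] by blast
    then show ?thesis
      using step by (subst Tset.simps) auto
  qed
qed

text \<open>Turns divergence of the minimum into a statement about \<open>avoids\<close>: a witness
  \<open>t \<le> a\<close> lies in \<open>Lset\<close> because \<open>a \<le> 0\<close>, and
  \<open>Lset\<close> is finite.\<close>

lemma Lmin_le_if_not_avoids:
  assumes "\<And>k. z k > 0" "\<And>k. w k > 0" "a \<le> 0" "\<not> avoids a z w n"
  shows "Lmin z w n \<le> a"
proof -
  obtain t where "t \<in> Tset z w n" "t \<le> a"
    using assms(4) by (auto simp: avoids_def not_less)
  then have "t \<in> Lset z w n" using assms(3) by (simp add: Lset_def)
  moreover have "finite (Lset z w n)" by (simp add: Lset_def finite_Tset)
  ultimately show ?thesis
    unfolding Lmin_def using Min_le \<open>t \<le> a\<close> by (meson order.trans)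
qed

text \<open>The tree of \<open>m\<close> reads only the steps attached to the sites 1 to
  \<open>m\<close>. This locality is what later separates the past from the steps taken at a new
  site.\<close>

lemma avoids_cong:
  assumes "a \<le> 0" "\<And>k. 1 \<le> k \<Longrightarrow> int k \<le> m \<Longrightarrow> z k = z' k" "\<And>k. 1 \<le> k \<Longrightarrow> int k \<le> m \<Longrightarrow> w k = w' k"
  shows "avoids a z w m \<longleftrightarrow> avoids a z' w' m"
  using assms(2,3)
proof (induction "nat m" arbitrary: m rule: less_induct)
  case less
  show ?case
  proof (cases "m \<ge> 1")
    case True
    have eq: "z (nat m) = z' (nat m)" "w (nat m) = w' (nat m)"
      using True less.prems by auto
    have IH: "avoids a z w (m - int k) \<longleftrightarrow> avoids a z' w' (m - int k)" if "k > 0" for k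
      using True that by (intro less.hyps less.prems) auto
    show ?thesis
      using IH[of "z' (nat m)"] IH[of "w' (nat m)"] avoids_pos[OF assms(1) True] eq by auto
  next
    case False
    then show ?thesis by (simp add: avoids_nonpos)
  qed
qed

lemma past_cong:
  assumes "a \<le> 0" "\<And>k. 1 \<le> k \<Longrightarrow> int k < n \<Longrightarrow> z k = z' k" "\<And>k. 1 \<le> k \<Longrightarrow> int k < n \<Longrightarrow> w k = w' k"
  shows "past a z w n = past a z' w' n"
  unfolding past_def using assms by (intro Collect_cong conj_cong refl avoids_cong) auto

lemma past_subset: "past a z w n \<subseteq> {a<..<n}"
  by (auto simp: past_def dest: avoids_greater)

text \<open>Measurability is assumed only for the coordinates that are read, so the lemma serves
  both the full probability space and a product over finitely many coordinates.\<close>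

lemma measurable_avoids:
  assumes "a \<le> 0"
    and "\<And>k. 1 \<le> k \<Longrightarrow> int k \<le> m \<Longrightarrow> (\<lambda>x. z x k) \<in> measurable N (count_space UNIV)"
    and "\<And>k. 1 \<le> k \<Longrightarrow> int k \<le> m \<Longrightarrow> (\<lambda>x. w x k) \<in> measurable N (count_space UNIV)"
  shows "Measurable.pred N (\<lambda>x. avoids a (z x) (w x) m)"
  using assms(2,3)
proof (induction "nat m" arbitrary: m rule: less_induct)
  case less
  show ?case
  proof (cases "m \<ge> 1")
    case True
    have [measurable]: "(\<lambda>x. z x (nat m)) \<in> measurable N (count_space UNIV)"
        "(\<lambda>x. w x (nat m)) \<in> measurable N (count_space UNIV)"
      using True less.prems by auto
    have [measurable]: "Measurable.pred N (\<lambda>x. avoids a (z x) (w x) (m - int (Suc k)))" for k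
      using True by (intro less.hyps less.prems) auto
    \<comment> \<open>Step values are split as \<open>Suc i\<close> and \<open>Suc j\<close>, so
      that the induction hypothesis applies to strictly smaller sites and only countable
      disjunctions remain.\<close>
    have eq: "(\<lambda>x. avoids a (z x) (w x) m) = (\<lambda>x. z x (nat m) = 0 \<or> w x (nat m) = 0 \<or>
        (\<exists>i j. z x (nat m) = Suc i \<and> w x (nat m) = Suc j \<and>
           avoids a (z x) (w x) (m - int (Suc i)) \<and> avoids a (z x) (w x) (m - int (Suc j))))"
    proof
      fix x
      show "avoids a (z x) (w x) m = (z x (nat m) = 0 \<or> w x (nat m) = 0 \<or>
        (\<exists>i j. z x (nat m) = Suc i \<and> w x (nat m) = Suc j \<and>
           avoids a (z x) (w x) (m - int (Suc i)) \<and> avoids a (z x) (w x) (m - int (Suc j))))"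
        unfolding avoids_pos[OF assms(1) True]
        by (cases "z x (nat m)"; cases "w x (nat m)") auto
    qed
    show ?thesis unfolding eq by measurable
  next
    case False
    then show ?thesis by (simp add: avoids_nonpos)
  qed
qed

lemma measurable_past:
  assumes "a \<le> 0"
    and "\<And>k. 1 \<le> k \<Longrightarrow> int k < n \<Longrightarrow> (\<lambda>x. z x k) \<in> measurable N (count_space UNIV)"
    and "\<And>k. 1 \<le> k \<Longrightarrow> int k < n \<Longrightarrow> (\<lambda>x. w x k) \<in> measurable N (count_space UNIV)"
  shows "Measurable.pred N (\<lambda>x. past a (z x) (w x) n = S)"
proof -
  have [measurable]: "Measurable.pred N (\<lambda>x. avoids a (z x) (w x) m)" if "m < n" for m
    using assms that by (intro measurable_avoids) auto
  have [measurable]: "Measurable.pred N (\<lambda>x. m \<in> past a (z x) (w x) n)" for m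
    by (cases "m < n") (auto simp: past_def)
  have eq: "(\<lambda>x. past a (z x) (w x) n = S) = (\<lambda>x. \<forall>m. m \<in> past a (z x) (w x) n \<longleftrightarrow> m \<in> S)"
    by (auto simp: set_eq_iff)
  show ?thesis unfolding eq by measurable
qed

section \<open>Probability of stepping into the avoiding sites: sum bound and one-site
  estimates\<close>

lemma hit_nonneg: "hit q n S \<ge> 0" and hit_le_1: "hit q n S \<le> 1"
  by (simp_all add: hit_def)

lemma hit_mult_nonneg: "0 \<le> hit q n S * (1 - hit q n S)"
  using hit_nonneg hit_le_1 by simp

text \<open>A step \<open>i\<close> from \<open>n\<close> corresponds to the landing site
  \<open>b = n - i\<close>; all these sites lie below \<open>n\<close>, so \<open>nat\<close>
  truncates nothing.\<close>

lemma hit_past_eq_sum: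
  "hit q n (past a z w n) =
     (\<Sum>b \<in> {a<..<n}. of_bool (avoids a z w b) * pmf q (nat (n - b)))"
proof -
  let ?B = "{b \<in> {a<..<n}. avoids a z w b}"
  have fin: "finite ?B" by (rule finite_subset[of _ "{a<..<n}"]) auto
  have set: "{i. n - int i \<in> past a z w n} = (\<lambda>b. nat (n - b)) ` ?B"
  proof (intro equalityI subsetI)
    fix i assume "i \<in> {i. n - int i \<in> past a z w n}"
    then have "n - int i \<in> ?B" using past_subset by (auto simp: past_def dest: avoids_greater)
    moreover have "i = nat (n - (n - int i))" by simp
    ultimately show "i \<in> (\<lambda>b. nat (n - b)) ` ?B" by blast
  qed (auto simp: past_def)
  have "hit q n (past a z w n) = (\<Sum>i \<in> (\<lambda>b. nat (n - b)) ` ?B. pmf q i)"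
    unfolding hit_def set by (intro measure_measure_pmf_finite finite_imageI fin)
  also have "\<dots> = (\<Sum>b \<in> ?B. pmf q (nat (n - b)))"
    by (intro sum.reindex_cong[OF _ refl refl]) (auto simp: inj_on_def)
  also have "\<dots> = (\<Sum>b \<in> {a<..<n}. of_bool (avoids a z w b) * pmf q (nat (n - b)))"
    by (intro sum.mono_neutral_cong_left) auto
  finally show ?thesis .
qed

text \<open>Double counting: exchange the sum over starting sites with the sum over landing sites. A
  fixed landing site receives masses of distinct step lengths, at most 1 in total; the sites in
  \<open>{a<..0}\<close> account for the term \<open>- a\<close>.\<close>

lemma sum_hit_past_le:
  assumes "a \<le> 0"
  shows "(\<Sum>n<N. hit q (int (Suc n)) (past a z w (int (Suc n))))
    \<le> - real_of_int a + (\<Sum>n<N. of_bool (avoids a z w (int (Suc n))))"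
proof -
  let ?I = "{a<..int N}" and ?A = "\<lambda>b. of_bool (avoids a z w b) :: real"
  \<comment> \<open>Padding with zero terms gives all inner sums the common range \<open>?I\<close>,
    so the two sums can be swapped.\<close>
  have "(\<Sum>n<N. hit q (int (Suc n)) (past a z w (int (Suc n))))
      = (\<Sum>n<N. \<Sum>b \<in> ?I. ?A b * (if b < int (Suc n) then pmf q (nat (int (Suc n) - b)) else 0))"
    unfolding hit_past_eq_sum
    by (intro sum.cong refl sum.mono_neutral_cong_left) auto
  also have "\<dots> = (\<Sum>b \<in> ?I. ?A b *
      (\<Sum>n<N. if b < int (Suc n) then pmf q (nat (int (Suc n) - b)) else 0))"
    by (subst sum.swap) (simp add: sum_distrib_left)
  also have "\<dots> \<le> (\<Sum>b \<in> ?I. ?A b)"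
  proof (intro sum_mono mult_left_le)
    fix b
    let ?J = "{n \<in> {..<N}. b < int (Suc n)}"
    have "(\<Sum>n<N. if b < int (Suc n) then pmf q (nat (int (Suc n) - b)) else 0)
        = (\<Sum>n \<in> ?J. pmf q (nat (int (Suc n) - b)))"
      by (intro sum.mono_neutral_cong_right) auto
    also have "\<dots> = (\<Sum>i \<in> (\<lambda>n. nat (int (Suc n) - b)) ` ?J. pmf q i)"
      by (subst sum.reindex) (auto simp: inj_on_def)
    also have "\<dots> = measure_pmf.prob q ((\<lambda>n. nat (int (Suc n) - b)) ` ?J)"
      by (intro measure_measure_pmf_finite[symmetric]) auto
    also have "\<dots> \<le> 1" by simp
    finally show "(\<Sum>n<N. if b < int (Suc n) then pmf q (nat (int (Suc n) - b)) else 0) \<le> 1" .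
  qed auto
  also have "\<dots> = (\<Sum>b \<in> {a<..0}. ?A b) + (\<Sum>b \<in> {0<..int N}. ?A b)"
    using assms by (subst sum.union_disjoint[symmetric]) (simp_all add: ivl_disj_un_two(6) ivl_disj_int_two(6))
  also have "(\<Sum>b \<in> {a<..0}. ?A b) \<le> (\<Sum>b \<in> {a<..0}. 1)"
    by (intro sum_mono) auto
  also have "(\<Sum>b \<in> {a<..0}. 1::real) = - real_of_int a"
    using assms by simp
  also have "{0<..int N} = (\<lambda>n. int (Suc n)) ` {..<N}"
  proof (intro equalityI subsetI)
    fix b assume "b \<in> {0<..int N}"
    then have "b = int (Suc (nat (b - 1)))" "nat (b - 1) \<in> {..<N}" by auto
    then show "b \<in> (\<lambda>n. int (Suc n)) ` {..<N}" by blast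
  qed auto
  also have "(\<Sum>b \<in> (\<lambda>n. int (Suc n)) ` {..<N}. ?A b) = (\<Sum>n<N. ?A (int (Suc n)))"
    by (subst sum.reindex) (auto simp: inj_on_def)
  finally show ?thesis by simp
qed

text \<open>Ensures that the smaller of the two masses is at most 1/2, so the regions near 0 and
  near 1 used below do not overlap.\<close>

lemma pmf_1_plus_pmf_2_le: "pmf q (1::nat) + pmf q 2 \<le> 1"
proof -
  have "pmf q 1 + pmf q 2 = measure_pmf.prob q {1, 2}"
    by (subst measure_measure_pmf_finite) auto
  then show ?thesis by simp
qed

text \<open>The mean of a variable with values in the naturals is the sum of its tail probabilities,
  and a shift by \<open>k\<close> does not affect summability.\<close>

lemma not_summable_tail_prob:
  assumes "(\<integral>\<^sup>+ i. ennreal (real i) \<partial>measure_pmf q) = \<infinity>"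
  shows "\<not> summable (\<lambda>n. measure_pmf.prob q {i. n + k < i})"
proof
  assume "summable (\<lambda>n. measure_pmf.prob q {i. n + k < i})"
  then have summ: "summable (\<lambda>n. measure_pmf.prob q {i. n < i})"
    using summable_iff_shift[of "\<lambda>n. measure_pmf.prob q {i. n < i}" k] by simp
  have "(\<integral>\<^sup>+ i. ennreal (real i) \<partial>measure_pmf q) = (\<integral>\<^sup>+ i. of_nat i \<partial>measure_pmf q)"
    by (simp add: ennreal_of_nat_eq_real_of_nat)
  also have "\<dots> = (\<Sum>n. emeasure (measure_pmf q) {i. n < i})"
    using nn_integral_nat_function[of "\<lambda>i. i" "measure_pmf q"] by simp
  also have "\<dots> = (\<Sum>n. ennreal (measure_pmf.prob q {i. n < i}))"
    by (simp add: measure_pmf.emeasure_eq_measure)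
  also have "\<dots> < \<infinity>"
    using summ by (simp add: suminf_ennreal2)
  finally show False using assms by simp
qed

text \<open>A step of length 1 from \<open>n + 1\<close> lands on \<open>n\<close>. Used
  contrapositively: a small hitting probability excludes the preceding site.\<close>

lemma pmf_1_le_hit_past:
  assumes "avoids a z w n"
  shows "pmf q 1 \<le> hit q (n + 1) (past a z w (n + 1))"
proof -
  have "pmf q 1 = measure_pmf.prob q {1}" by (simp add: measure_pmf_single)
  also have "\<dots> \<le> hit q (n + 1) (past a z w (n + 1))"
    unfolding hit_def using assms
    by (intro measure_pmf.finite_measure_mono) (auto simp: past_def)
  finally show ?thesis .
qed

lemma hit_past_le_pmf_2:
  assumes "\<not> avoids a z w n"
  shows "hit q (n + 2) (past a z w (n + 2)) \<le> 1 - pmf q 2"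
proof -
  have "hit q (n + 2) (past a z w (n + 2)) \<le> measure_pmf.prob q (space (measure_pmf q) - {2})"
    unfolding hit_def using assms
    by (intro measure_pmf.finite_measure_mono) (auto simp: past_def)
  also have "\<dots> = 1 - pmf q 2"
    by (subst measure_pmf.prob_compl) (auto simp: measure_pmf_single)
  finally show ?thesis .
qed

text \<open>From site \<open>Suc n\<close>, a step \<open>i\<close> lands at or below
  \<open>a\<close> exactly when \<open>i > n + nat (- a)\<close>, and no such landing site avoids
  \<open>a\<close>.\<close>

lemma tail_prob_le_hit_past:
  assumes "a \<le> 0"
  shows "measure_pmf.prob q {i. n + nat (- a) < i}
    \<le> 1 - hit q (int (Suc n)) (past a z w (int (Suc n)))"
proof -
  have "hit q (int (Suc n)) (past a z w (int (Suc n)))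
      \<le> measure_pmf.prob q (space (measure_pmf q) - {i. n + nat (- a) < i})"
    unfolding hit_def using assms
    by (intro measure_pmf.finite_measure_mono) (auto simp: past_def dest: avoids_greater)
  also have "\<dots> = 1 - measure_pmf.prob q {i. n + nat (- a) < i}"
    by (subst measure_pmf.prob_compl) auto
  finally show ?thesis by simp
qed

text \<open>The pathwise part of the argument: \<open>z\<close> and \<open>w\<close> are one
  realisation, and \<open>summ\<close> and \<open>ev\<close> are the two properties later shown to
  hold almost surely. Note the shift: \<open>P n\<close> belongs to site \<open>Suc n\<close>. The
  threshold is at most \<open>pmf q 1\<close>, to exclude a site, and at most
  \<open>pmf q 2\<close>, to prevent a jump up.\<close>

lemma eventually_not_avoids:
  fixes q a z w
  defines "P \<equiv> \<lambda>n. hit q (int (Suc n)) (past a z w (int (Suc n)))"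
    and "\<epsilon> \<equiv> min (pmf q 1) (pmf q 2)"
  assumes a: "a \<le> 0" and pos: "\<epsilon> > 0"
    and mean: "(\<integral>\<^sup>+ i. ennreal (real i) \<partial>measure_pmf q) = \<infinity>"
    and summ: "summable (\<lambda>n. P n * (1 - P n))"
    and ev: "eventually (\<lambda>n. \<not> (avoids a z w (int (Suc n)) \<and> P n \<le> 1 - \<epsilon>)) sequentially"
  shows "eventually (\<lambda>n. \<not> avoids a z w (int n)) sequentially"
proof -
  have eps: "\<epsilon> \<le> 1 / 2"
    using pmf_1_plus_pmf_2_le[of q] unfolding \<epsilon>_def by linarith
  have P01: "0 \<le> P n" "P n \<le> 1" for n
    by (simp_all add: P_def hit_nonneg hit_le_1)
  have "(\<lambda>n. P n * (1 - P n)) \<longlonglongrightarrow> 0"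
    using summ by (rule summable_LIMSEQ_zero)
  moreover have "0 < \<epsilon> * (1 - \<epsilon>)" using pos eps by simp
  ultimately have "eventually (\<lambda>n. P n * (1 - P n) < \<epsilon> * (1 - \<epsilon>)) sequentially"
    by (rule order_tendstoD(2))
  then obtain n0 where n0: "\<And>n. n \<ge> n0 \<Longrightarrow> P n * (1 - P n) < \<epsilon> * (1 - \<epsilon>)"
    by (auto simp: eventually_sequentially)
  have dichotomy: "P n < \<epsilon> \<or> 1 - \<epsilon> < P n" if "n \<ge> n0" for n
  proof (rule ccontr)
    assume "\<not> ?thesis"
    \<comment> \<open>Concavity of \<open>x * (1 - x)\<close>, in factored form: between the two
      thresholds it is at least its value at \<open>\<epsilon>\<close>.\<close>
    then have "0 \<le> (P n - \<epsilon>) * (1 - \<epsilon> - P n)" by simp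
    also have "\<dots> = P n * (1 - P n) - \<epsilon> * (1 - \<epsilon>)" by (simp add: algebra_simps)
    finally show False using n0[OF that] by simp
  qed
  have step: "P (Suc n) < \<epsilon>" if "n \<ge> n0" "P n < \<epsilon>" for n
  proof -
    \<comment> \<open>\<open>P n\<close> concerns site \<open>n + 1\<close>, one step above
      \<open>n\<close>; \<open>P (Suc n)\<close> concerns site \<open>n + 2\<close>, from which a
      step of length 2 reaches \<open>n\<close>.\<close>
    have "\<not> avoids a z w (int n)"
      using pmf_1_le_hit_past[of a z w "int n" q] that(2) by (auto simp: P_def \<epsilon>_def add.commute)
    then have "P (Suc n) \<le> 1 - pmf q 2"
      using hit_past_le_pmf_2[of a z w "int n" q] by (simp add: P_def add.commute)
    then have "P (Suc n) \<le> 1 - \<epsilon>" by (simp add: \<epsilon>_def)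
    then show ?thesis using dichotomy[of "Suc n"] that(1) by auto
  qed
  have "\<exists>n1 \<ge> n0. P n1 < \<epsilon>"
  proof (rule ccontr)
    assume "\<not> ?thesis"
    then have large: "1 - \<epsilon> < P n" if "n \<ge> n0" for n using dichotomy that by auto
    have "summable (\<lambda>n. measure_pmf.prob q {i. n + nat (- a) < i})"
    proof (rule summable_comparison_test_ev)
      show "summable (\<lambda>n. 2 * (P n * (1 - P n)))" using summ by (rule summable_mult)
      show "eventually (\<lambda>n. norm (measure_pmf.prob q {i. n + nat (- a) < i}) \<le> 2 * (P n * (1 - P n))) sequentially"
        using eventually_ge_at_top[of n0]
      proof eventually_elim
        case (elim n)
        \<comment> \<open>The factor 2 comes from
          \<open>P n > 1 - \<epsilon> \<ge> 1 / 2\<close>.\<close>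
        have "1 * (1 - P n) \<le> (2 * P n) * (1 - P n)"
          using large[OF elim] eps P01[of n] by (intro mult_right_mono) auto
        then show ?case
          using tail_prob_le_hit_past[OF a, of q n z w] by (simp add: P_def)
      qed
    qed
    then show False using not_summable_tail_prob[OF mean] by blast
  qed
  then obtain n1 where n1: "n1 \<ge> n0" "P n1 < \<epsilon>" by blast
  have small: "P n < \<epsilon>" if "n \<ge> n1" for n
    using that by (induction n rule: dec_induct) (use n1 step in auto)
  have "eventually (\<lambda>n. \<not> avoids a z w (int (Suc n))) sequentially"
    using ev eventually_ge_at_top[of n1]
  proof eventually_elim
    case (elim n)
    \<comment> \<open>Since \<open>\<epsilon> \<le> 1 / 2\<close>, a value below
      \<open>\<epsilon>\<close> is also at most \<open>1 - \<epsilon>\<close>, so \<open>ev\<close>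
      excludes avoidance.\<close>
    then show ?case using small[of n] eps by auto
  qed
  then show ?thesis by (subst (asm) eventually_sequentially_Suc)
qed

section \<open>The random model and independence of new steps from the past\<close>

text \<open>The sum type merges both sequences into one family, so a single
  \<open>indep_vars\<close> expresses their joint independence.\<close>

locale double_walk = prob_space M for M :: "'a measure" +
  fixes Z W :: "nat \<Rightarrow> 'a \<Rightarrow> nat" and q :: "nat pmf"
  assumes indep: "indep_vars (\<lambda>_. count_space UNIV) (\<lambda>i. case i of Inl n \<Rightarrow> Z n | Inr n \<Rightarrow> W n) UNIV"
    and distr_Z: "\<And>n. distr M (count_space UNIV) (Z n) = measure_pmf q"
    and distr_W: "\<And>n. distr M (count_space UNIV) (W n) = measure_pmf q"
    and pmf_0: "pmf q 0 = 0"
begin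

definition state :: "int \<Rightarrow> nat \<Rightarrow> 'a \<Rightarrow> int set" where
  "state a n \<omega> = past a (\<lambda>k. Z k \<omega>) (\<lambda>k. W k \<omega>) (int n)"

definition avoid_event :: "int \<Rightarrow> nat \<Rightarrow> 'a \<Rightarrow> bool" where
  "avoid_event a n \<omega> \<longleftrightarrow> avoids a (\<lambda>k. Z k \<omega>) (\<lambda>k. W k \<omega>) (int n)"

lemma measurable_Z [measurable]: "Z n \<in> measurable M (count_space UNIV)"
  and measurable_W [measurable]: "W n \<in> measurable M (count_space UNIV)"
proof -
  have "\<forall>i\<in>UNIV. (case i of Inl n \<Rightarrow> Z n | Inr n \<Rightarrow> W n) \<in> measurable M (count_space UNIV)"
    using indep unfolding indep_vars_def by blast
  from bspec[OF this, of "Inl n"] bspec[OF this, of "Inr n"]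
  show "Z n \<in> measurable M (count_space UNIV)" "W n \<in> measurable M (count_space UNIV)"
    by simp_all
qed

lemma pred_state: "a \<le> 0 \<Longrightarrow> Measurable.pred M (\<lambda>\<omega>. state a n \<omega> = S)"
  unfolding state_def by (intro measurable_past) auto

lemma pred_avoid_event: "a \<le> 0 \<Longrightarrow> Measurable.pred M (avoid_event a n)"
  unfolding avoid_event_def by (intro measurable_avoids) auto

lemma prob_step_Z: "prob {\<omega> \<in> space M. int n - int (Z k \<omega>) \<in> S} = hit q (int n) S"
  and prob_step_W: "prob {\<omega> \<in> space M. int n - int (W k \<omega>) \<in> S} = hit q (int n) S"
proof -
  have "measure (distr M (count_space UNIV) V) {i. int n - int i \<in> S} = prob {\<omega> \<in> space M. int n - int (V \<omega>) \<in> S}"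
    if "V \<in> measurable M (count_space UNIV)" for V
    using that by (simp add: measure_distr vimage_def Int_def conj_commute)
  from this[OF measurable_Z[of k]] this[OF measurable_W[of k]]
  show "prob {\<omega> \<in> space M. int n - int (Z k \<omega>) \<in> S} = hit q (int n) S"
    "prob {\<omega> \<in> space M. int n - int (W k \<omega>) \<in> S} = hit q (int n) S"
    by (simp_all add: hit_def distr_Z distr_W)
qed

lemma AE_steps_pos: "AE \<omega> in M. \<forall>k. Z k \<omega> > 0 \<and> W k \<omega> > 0"
proof -
  have "AE i in measure_pmf q. 0 < i"
    using pmf_0 by (auto simp: AE_measure_pmf_iff set_pmf_iff intro!: gr0I)
  then have "AE \<omega> in M. 0 < Z k \<omega>" "AE \<omega> in M. 0 < W k \<omega>" for k
    using AE_distr_iff[OF measurable_Z[of k], of "\<lambda>i. 0 < i"] AE_distr_iff[OF measurable_W[of k], of "\<lambda>i. 0 < i"]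
    unfolding distr_Z distr_W by auto
  then show ?thesis by (auto simp: AE_all_countable)
qed

text \<open>The past at \<open>Suc n\<close> is a function of the steps with index at most
  \<open>n\<close>, hence independent of the two steps at \<open>Suc n\<close>, which are
  independent of each other.\<close>

lemma prob_state_steps:
  assumes a: "a \<le> 0"
  shows "prob {\<omega> \<in> space M. state a (Suc n) \<omega> = S \<and>
      int (Suc n) - int (Z (Suc n) \<omega>) \<in> S \<and> int (Suc n) - int (W (Suc n) \<omega>) \<in> S}
    = prob {\<omega> \<in> space M. state a (Suc n) \<omega> = S} * (hit q (int (Suc n)) S)\<^sup>2"
proof -
  let ?X = "\<lambda>i \<omega>. case i of Inl n \<Rightarrow> Z n \<omega> | Inr n \<Rightarrow> W n \<omega>"
  \<comment> \<open>Three disjoint blocks of coordinates: the past, the new \<open>Z\<close> step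
    and the new \<open>W\<close> step. \<open>Y\<close> reads one truth value off each
    block.\<close>
  define G :: "nat \<Rightarrow> (nat + nat) set" where
    "G j = (if j = 0 then Inl ` {..n} \<union> Inr ` {..n} else if j = 1 then {Inl (Suc n)} else {Inr (Suc n)})" for j
  define Y :: "nat \<Rightarrow> (nat + nat \<Rightarrow> nat) \<Rightarrow> bool" where
    "Y j x = (if j = 0 then past a (\<lambda>k. x (Inl k)) (\<lambda>k. x (Inr k)) (int (Suc n)) = S
      else if j = 1 then int (Suc n) - int (x (Inl (Suc n))) \<in> S
      else int (Suc n) - int (x (Inr (Suc n))) \<in> S)" for j x
  define V where "V j \<omega> = Y j (restrict (\<lambda>i. ?X i \<omega>) (G j))" for j \<omega>
  have ind: "indep_vars (\<lambda>_. count_space UNIV) ?X UNIV"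
  proof -
    have "?X = (\<lambda>i. case i of Inl n \<Rightarrow> Z n | Inr n \<Rightarrow> W n)"
      by (auto simp: fun_eq_iff split: sum.split)
    then show ?thesis using indep by simp
  qed
  have "indep_vars (\<lambda>j. PiM (G j) (\<lambda>_. count_space UNIV)) (\<lambda>j \<omega>. restrict (\<lambda>i. ?X i \<omega>) (G j)) {0, 1, 2}"
    by (rule indep_vars_restrict[OF ind]) (auto simp: disjoint_family_on_def G_def)
  then have iv: "indep_vars (\<lambda>_. count_space UNIV) V {0, 1, 2}"
    unfolding V_def
  proof (rule indep_vars_compose2)
    fix j :: nat assume "j \<in> {0, 1, 2}"
    have comp: "(\<lambda>x. x i) \<in> measurable (PiM (G j) (\<lambda>_. count_space UNIV)) (count_space UNIV)"
      if "i \<in> G j" for i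
      using that by (rule measurable_component_singleton)
    show "Y j \<in> measurable (PiM (G j) (\<lambda>_. count_space UNIV)) (count_space UNIV)"
    proof (cases "j = 0")
      case True
      have "Measurable.pred (PiM (G j) (\<lambda>_. count_space UNIV))
          (\<lambda>x. past a (\<lambda>k. x (Inl k)) (\<lambda>k. x (Inr k)) (int (Suc n)) = S)"
        using a True by (intro measurable_past comp) (auto simp: G_def)
      then show ?thesis using True by (simp add: Y_def[abs_def])
    next
      case False
      let ?i = "if j = 1 then Inl (Suc n) else Inr (Suc n)"
      have "Y j = (\<lambda>i. int (Suc n) - int i \<in> S) \<circ> (\<lambda>x. x ?i)"
        using False by (auto simp: Y_def fun_eq_iff)
      moreover have "?i \<in> G j" using False by (simp add: G_def)
      ultimately show ?thesis
        using measurable_comp[OF comp, of ?i "\<lambda>i. int (Suc n) - int i \<in> S" "count_space UNIV"] by simp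
    qed
  qed
  have V0: "V 0 \<omega> \<longleftrightarrow> state a (Suc n) \<omega> = S" for \<omega>
  proof -
    \<comment> \<open>\<open>restrict\<close> alters only coordinates outside block 0, which by
      locality do not influence the past.\<close>
    have "past a (\<lambda>k. restrict (\<lambda>i. ?X i \<omega>) (G 0) (Inl k)) (\<lambda>k. restrict (\<lambda>i. ?X i \<omega>) (G 0) (Inr k)) (int (Suc n))
        = state a (Suc n) \<omega>"
      unfolding state_def using a by (intro past_cong) (auto simp: G_def)
    then show ?thesis by (simp add: V_def Y_def)
  qed
  have V1: "V 1 \<omega> \<longleftrightarrow> int (Suc n) - int (Z (Suc n) \<omega>) \<in> S"
    and V2: "V 2 \<omega> \<longleftrightarrow> int (Suc n) - int (W (Suc n) \<omega>) \<in> S" for \<omega>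
    by (simp_all add: V_def Y_def G_def)
  have "prob (\<Inter>j\<in>{0, 1, 2}. V j -` {True} \<inter> space M) = (\<Prod>j\<in>{0, 1, 2}. prob (V j -` {True} \<inter> space M))"
    by (rule indep_varsD[OF iv]) auto
  moreover have "(\<Inter>j\<in>{0, 1, 2}. V j -` {True} \<inter> space M) = {\<omega> \<in> space M. V 0 \<omega> \<and> V 1 \<omega> \<and> V 2 \<omega>}"
    by auto
  moreover have "V j -` {True} \<inter> space M = {\<omega> \<in> space M. V j \<omega>}" for j
    by auto
  ultimately have "prob {\<omega> \<in> space M. V 0 \<omega> \<and> V 1 \<omega> \<and> V 2 \<omega>}
      = prob {\<omega> \<in> space M. V 0 \<omega>} * (prob {\<omega> \<in> space M. V 1 \<omega>} * prob {\<omega> \<in> space M. V 2 \<omega>})"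
    by simp
  then show ?thesis
    unfolding V0 V1 V2 prob_step_Z prob_step_W by (simp add: power2_eq_square)
qed

text \<open>The conditional probability of joining \<open>B\<close> is the square of the hitting
  probability, written in product form. The events agree only almost everywhere, because a step of
  value 0 would trigger the guard in \<open>Tset\<close>.\<close>

lemma prob_avoid_state_eq:
  assumes a: "a \<le> 0"
  shows "prob {\<omega> \<in> space M. avoid_event a (Suc n) \<omega> \<and> state a (Suc n) \<omega> = S}
    = prob {\<omega> \<in> space M. state a (Suc n) \<omega> = S} * (hit q (int (Suc n)) S)\<^sup>2"
proof -
  note [measurable] = pred_state[OF a] pred_avoid_event[OF a]
  have step: "avoid_event a (Suc n) \<omega> \<longleftrightarrow>
      int (Suc n) - int (Z (Suc n) \<omega>) \<in> state a (Suc n) \<omega> \<and>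
      int (Suc n) - int (W (Suc n) \<omega>) \<in> state a (Suc n) \<omega>"
    if "\<forall>k. Z k \<omega> > 0 \<and> W k \<omega> > 0" for \<omega>
  proof -
    have "Z (Suc n) \<omega> > 0" "W (Suc n) \<omega> > 0" using that by auto
    then show ?thesis
      using avoids_pos[OF a, of "int (Suc n)" "\<lambda>k. Z k \<omega>" "\<lambda>k. W k \<omega>"]
      unfolding avoid_event_def state_def past_def by (simp del: of_nat_Suc)
  qed
  have "prob {\<omega> \<in> space M. avoid_event a (Suc n) \<omega> \<and> state a (Suc n) \<omega> = S}
    = prob {\<omega> \<in> space M. state a (Suc n) \<omega> = S \<and>
      int (Suc n) - int (Z (Suc n) \<omega>) \<in> S \<and> int (Suc n) - int (W (Suc n) \<omega>) \<in> S}"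
  proof (rule finite_measure_eq_AE)
    show "AE \<omega> in M. \<omega> \<in> {\<omega> \<in> space M. avoid_event a (Suc n) \<omega> \<and> state a (Suc n) \<omega> = S} \<longleftrightarrow>
      \<omega> \<in> {\<omega> \<in> space M. state a (Suc n) \<omega> = S \<and>
        int (Suc n) - int (Z (Suc n) \<omega>) \<in> S \<and> int (Suc n) - int (W (Suc n) \<omega>) \<in> S}"
      using AE_steps_pos by eventually_elim (auto simp: step)
  qed measurable
  then show ?thesis using prob_state_steps[OF a] by simp
qed

section \<open>Moments of the hitting probabilities and their almost sure consequences\<close>

lemma state_mem: "state a n \<omega> \<in> Pow {a<..<int n}"
  unfolding state_def using past_subset by auto

text \<open>The past takes finitely many values, so any real function of it is simple and its
  expectation is a finite sum.\<close>

lemma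
  fixes f :: "int set \<Rightarrow> real"
  assumes a: "a \<le> 0"
  shows integrable_state: "integrable M (\<lambda>\<omega>. f (state a n \<omega>))"
    and expectation_state: "expectation (\<lambda>\<omega>. f (state a n \<omega>))
      = (\<Sum>S \<in> Pow {a<..<int n}. f S * prob {\<omega> \<in> space M. state a n \<omega> = S})"
proof -
  note [measurable] = pred_state[OF a]
  have ind: "f (state a n \<omega>)
      = (\<Sum>S \<in> Pow {a<..<int n}. f S * indicator {\<omega> \<in> space M. state a n \<omega> = S} \<omega>)"
    if "\<omega> \<in> space M" for \<omega>
  proof -
    have "(\<Sum>S \<in> Pow {a<..<int n}. f S * indicator {\<omega> \<in> space M. state a n \<omega> = S} \<omega>)
        = (\<Sum>S \<in> Pow {a<..<int n}. if S = state a n \<omega> then f S else 0)"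
      using that by (intro sum.cong) (auto simp: indicator_def)
    also have "\<dots> = f (state a n \<omega>)" using state_mem[of a n \<omega>] by (simp add: sum.delta)
    finally show ?thesis by simp
  qed
  have int: "integrable M (\<lambda>\<omega>. f S * indicator {\<omega> \<in> space M. state a n \<omega> = S} \<omega>)" for S
    by (intro integrable_mult_right integrable_real_indicator) (auto simp: less_top[symmetric])
  show "integrable M (\<lambda>\<omega>. f (state a n \<omega>))"
    by (subst Bochner_Integration.integrable_cong[OF refl ind], assumption) (intro Bochner_Integration.integrable_sum int)
  show "expectation (\<lambda>\<omega>. f (state a n \<omega>))
      = (\<Sum>S \<in> Pow {a<..<int n}. f S * prob {\<omega> \<in> space M. state a n \<omega> = S})"
    by (subst Bochner_Integration.integral_cong[OF refl ind], assumption, subst Bochner_Integration.integral_sum)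
       (rule int, intro sum.cong, auto simp: Int_absorb1 subset_eq)
qed

text \<open>Sums the product formula over the pasts in \<open>G\<close>. The choice
  \<open>UNIV\<close> gives a second moment; a threshold set gives the Borel-Cantelli
  estimate.\<close>

lemma prob_avoid_state_mem:
  assumes a: "a \<le> 0"
  shows "prob {\<omega> \<in> space M. avoid_event a (Suc n) \<omega> \<and> state a (Suc n) \<omega> \<in> G}
    = expectation (\<lambda>\<omega>. indicator G (state a (Suc n) \<omega>) * (hit q (int (Suc n)) (state a (Suc n) \<omega>))\<^sup>2)"
proof -
  note [measurable] = pred_state[OF a] pred_avoid_event[OF a]
  let ?R = "Pow {a<..<int (Suc n)}"
  let ?E = "\<lambda>S. {\<omega> \<in> space M. avoid_event a (Suc n) \<omega> \<and> state a (Suc n) \<omega> = S}"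
  have "{\<omega> \<in> space M. avoid_event a (Suc n) \<omega> \<and> state a (Suc n) \<omega> \<in> G} = (\<Union>S \<in> ?R \<inter> G. ?E S)"
    using state_mem[of a "Suc n"] by blast
  also have "prob \<dots> = (\<Sum>S \<in> ?R \<inter> G. prob (?E S))"
    by (intro finite_measure_finite_Union) (auto simp: disjoint_family_on_def)
  also have "\<dots> = (\<Sum>S \<in> ?R. indicator G S * (hit q (int (Suc n)) S)\<^sup>2 * prob {\<omega> \<in> space M. state a (Suc n) \<omega> = S})"
    unfolding prob_avoid_state_eq[OF a]
    by (intro sum.mono_neutral_cong_left) (auto simp: indicator_def)
  also have "\<dots> = expectation (\<lambda>\<omega>. indicator G (state a (Suc n) \<omega>) * (hit q (int (Suc n)) (state a (Suc n) \<omega>))\<^sup>2)"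
    by (rule expectation_state[OF a, symmetric])
  finally show ?thesis .
qed

text \<open>Shifted by one to start at the first positive site.\<close>

definition hitp :: "int \<Rightarrow> nat \<Rightarrow> 'a \<Rightarrow> real" where
  "hitp a n \<omega> = hit q (int (Suc n)) (state a (Suc n) \<omega>)"

lemma integrable_hitp: "a \<le> 0 \<Longrightarrow> integrable M (\<lambda>\<omega>. f (hitp a n \<omega>) :: real)"
  unfolding hitp_def by (rule integrable_state)

lemma hitp_mult_nonneg: "0 \<le> hitp a n \<omega> * (1 - hitp a n \<omega>)"
  by (simp add: hitp_def hit_mult_nonneg)

text \<open>The expected number of avoiding sites in the pathwise bound equals the sum of the second
  moments of \<open>hitp\<close>; moving it to the left leaves the claim.\<close>

lemma sum_expectation_hitp_le:
  assumes a: "a \<le> 0"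
  shows "(\<Sum>n<N. expectation (\<lambda>\<omega>. hitp a n \<omega> * (1 - hitp a n \<omega>))) \<le> - real_of_int a"
proof -
  note [measurable] = pred_avoid_event[OF a]
  have sq: "expectation (\<lambda>\<omega>. (hitp a n \<omega>)\<^sup>2) = prob {\<omega> \<in> space M. avoid_event a (Suc n) \<omega>}" for n
    using prob_avoid_state_mem[OF a, of n UNIV] by (simp add: hitp_def)
  have ind: "expectation (\<lambda>\<omega>. of_bool (avoid_event a (Suc n) \<omega>)) = prob {\<omega> \<in> space M. avoid_event a (Suc n) \<omega>}" for n
  proof -
    have "expectation (\<lambda>\<omega>. of_bool (avoid_event a (Suc n) \<omega>))
        = expectation (indicator {\<omega> \<in> space M. avoid_event a (Suc n) \<omega>})"
      by (intro Bochner_Integration.integral_cong) (auto simp: indicator_def)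
    also have "\<dots> = prob {\<omega> \<in> space M. avoid_event a (Suc n) \<omega>}"
      by (simp add: Int_absorb1 subset_eq)
    finally show ?thesis .
  qed
  have intb: "integrable M (\<lambda>\<omega>. of_bool (avoid_event a (Suc n) \<omega>) :: real)" for n
    by (rule integrable_const_bound[where B = 1]) auto
  have int1: "integrable M (hitp a n)" and int2: "integrable M (\<lambda>\<omega>. (hitp a n \<omega>)\<^sup>2)" for n
    using integrable_hitp[OF a, of "\<lambda>x. x"] integrable_hitp[OF a, of "\<lambda>x. x\<^sup>2"] by auto
  have "(\<Sum>n<N. expectation (hitp a n)) = expectation (\<lambda>\<omega>. \<Sum>n<N. hitp a n \<omega>)"
    by (intro Bochner_Integration.integral_sum[symmetric] int1)
  also have "\<dots> \<le> expectation (\<lambda>\<omega>. - real_of_int a + (\<Sum>n<N. of_bool (avoid_event a (Suc n) \<omega>)))"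
  proof (intro integral_mono Bochner_Integration.integrable_add Bochner_Integration.integrable_sum
      int1 intb integrable_const)
    show "(\<Sum>n<N. hitp a n \<omega>) \<le> - real_of_int a + (\<Sum>n<N. of_bool (avoid_event a (Suc n) \<omega>))" for \<omega>
      unfolding hitp_def state_def avoid_event_def by (rule sum_hit_past_le[OF a])
  qed
  also have "\<dots> = - real_of_int a + (\<Sum>n<N. expectation (\<lambda>\<omega>. (hitp a n \<omega>)\<^sup>2))"
    by (subst Bochner_Integration.integral_add) (auto simp: intb sq ind prob_space simp del: sum_of_bool_eq)
  finally have "(\<Sum>n<N. expectation (hitp a n)) - (\<Sum>n<N. expectation (\<lambda>\<omega>. (hitp a n \<omega>)\<^sup>2)) \<le> - real_of_int a"
    by simp
  also have "(\<Sum>n<N. expectation (hitp a n)) - (\<Sum>n<N. expectation (\<lambda>\<omega>. (hitp a n \<omega>)\<^sup>2))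
      = (\<Sum>n<N. expectation (\<lambda>\<omega>. hitp a n \<omega> - (hitp a n \<omega>)\<^sup>2))"
    by (simp add: sum_subtractf[symmetric] int1 int2)
  also have "\<dots> = (\<Sum>n<N. expectation (\<lambda>\<omega>. hitp a n \<omega> * (1 - hitp a n \<omega>)))"
    by (simp add: right_diff_distrib power2_eq_square)
  finally show ?thesis .
qed

lemma summable_expectation_hitp:
  "a \<le> 0 \<Longrightarrow> summable (\<lambda>n. expectation (\<lambda>\<omega>. hitp a n \<omega> * (1 - hitp a n \<omega>)))"
  by (rule summableI_nonneg_bounded[OF _ sum_expectation_hitp_le])
     (auto intro!: Bochner_Integration.integral_nonneg hitp_mult_nonneg)

text \<open>By monotone convergence the random series has finite expectation, so it is finite almost
  surely.\<close>

lemma AE_summable_hitp: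
  assumes a: "a \<le> 0"
  shows "AE \<omega> in M. summable (\<lambda>n. hitp a n \<omega> * (1 - hitp a n \<omega>))"
proof -
  let ?f = "\<lambda>n \<omega>. hitp a n \<omega> * (1 - hitp a n \<omega>)"
  have int: "integrable M (?f n)" for n
    using integrable_hitp[OF a, of "\<lambda>x. x * (1 - x)"] .
  note [measurable] = borel_measurable_integrable[OF int]
  have "(\<integral>\<^sup>+ \<omega>. (\<Sum>n. ennreal (?f n \<omega>)) \<partial>M) = (\<Sum>n. \<integral>\<^sup>+ \<omega>. ennreal (?f n \<omega>) \<partial>M)"
    by (rule nn_integral_suminf) measurable
  also have "\<dots> = (\<Sum>n. ennreal (expectation (?f n)))"
    by (intro suminf_cong nn_integral_eq_integral int) (auto simp: hitp_mult_nonneg)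
  also have "\<dots> \<noteq> \<infinity>"
    using summable_expectation_hitp[OF a]
    by (subst suminf_ennreal2) (auto intro!: Bochner_Integration.integral_nonneg hitp_mult_nonneg)
  finally have "AE \<omega> in M. (\<Sum>n. ennreal (?f n \<omega>)) \<noteq> \<infinity>"
    by (intro nn_integral_PInf_AE) auto
  then show ?thesis
    by eventually_elim (auto intro!: summable_suminf_not_top hitp_mult_nonneg)
qed

text \<open>Where \<open>p \<le> 1 - \<epsilon>\<close>, the joining probability
  \<open>p\<^sup>2\<close> is at most \<open>p * (1 - p) / \<epsilon>\<close>, whose expectations
  are summable; the first Borel-Cantelli lemma applies.\<close>

lemma AE_eventually_not_avoid_small:
  assumes a: "a \<le> 0" and eps: "\<epsilon> > 0"
  shows "AE \<omega> in M. eventually (\<lambda>n. \<not> (avoid_event a (Suc n) \<omega> \<and> hitp a n \<omega> \<le> 1 - \<epsilon>)) sequentially"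
proof -
  note [measurable] = pred_avoid_event[OF a]
  have [measurable]: "hitp a n \<in> borel_measurable M" for n
    using integrable_hitp[OF a, of "\<lambda>x. x"] by auto
  let ?A = "\<lambda>n. {\<omega> \<in> space M. avoid_event a (Suc n) \<omega> \<and> hitp a n \<omega> \<le> 1 - \<epsilon>}"
  have le: "prob (?A n) \<le> expectation (\<lambda>\<omega>. hitp a n \<omega> * (1 - hitp a n \<omega>)) / \<epsilon>" for n
  proof -
    let ?G = "{S. hit q (int (Suc n)) S \<le> 1 - \<epsilon>}"
    have "prob (?A n) = expectation (\<lambda>\<omega>. indicator ?G (state a (Suc n) \<omega>) * (hit q (int (Suc n)) (state a (Suc n) \<omega>))\<^sup>2)"
      using prob_avoid_state_mem[OF a, of n ?G] by (simp add: hitp_def)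
    also have "\<dots> \<le> expectation (\<lambda>\<omega>. hitp a n \<omega> * (1 - hitp a n \<omega>) / \<epsilon>)"
    proof (intro integral_mono integrable_state[OF a] integrable_hitp[OF a])
      fix \<omega>
      let ?p = "hit q (int (Suc n)) (state a (Suc n) \<omega>)"
      have p: "0 \<le> ?p" "?p \<le> 1" by (simp_all add: hit_nonneg hit_le_1)
      have "?p\<^sup>2 \<le> ?p * (1 - ?p) / \<epsilon>" if "?p \<le> 1 - \<epsilon>"
      proof -
        have "?p * (?p * \<epsilon>) \<le> ?p * (1 - ?p)"
        proof (rule mult_left_mono)
          have "?p * \<epsilon> \<le> 1 * \<epsilon>" using p eps by (intro mult_right_mono) auto
          then show "?p * \<epsilon> \<le> 1 - ?p" using that by simp
        qed (use p in auto)
        then show ?thesis using eps by (simp add: pos_le_divide_eq power2_eq_square mult.assoc)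
      qed
      moreover have "0 \<le> ?p * (1 - ?p) / \<epsilon>" using p eps by simp
      ultimately show "indicator ?G (state a (Suc n) \<omega>) * ?p\<^sup>2 \<le> hitp a n \<omega> * (1 - hitp a n \<omega>) / \<epsilon>"
        by (auto simp: hitp_def indicator_def)
    qed
    finally show ?thesis by simp
  qed
  have "summable (\<lambda>n. prob (?A n))"
    by (rule summable_comparison_test'[OF summable_divide[OF summable_expectation_hitp[OF a]]])
       (use le in auto)
  then have "AE \<omega> in M. eventually (\<lambda>n. \<omega> \<in> space M - ?A n) sequentially"
    by (intro borel_cantelli_AE1) (auto simp: less_top[symmetric])
  then show ?thesis
    by eventually_elim (auto elim: eventually_mono)
qed

end

theorem theorem3:
  fixes M :: "'a measure" and Z W :: "nat \<Rightarrow> 'a \<Rightarrow> nat" and q :: "nat pmf"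
  assumes "prob_space M"
    and "prob_space.indep_vars M (\<lambda>_. count_space UNIV) (\<lambda>i. case i of Inl n \<Rightarrow> Z n | Inr n \<Rightarrow> W n) UNIV"
    and "\<And>n. distr M (count_space UNIV) (Z n) = measure_pmf q"
    and "\<And>n. distr M (count_space UNIV) (W n) = measure_pmf q"
    and "pmf q 0 = 0"
    and "\<And>i. i \<ge> 1 \<Longrightarrow> pmf q i > 0"
    and "(\<integral>\<^sup>+ i. ennreal (real i) \<partial>measure_pmf q) = \<infinity>"
  shows "AE \<omega> in M. filterlim (\<lambda>n::nat. Lmin (\<lambda>k. Z k \<omega>) (\<lambda>k. W k \<omega>) (int n)) at_bot sequentially"
proof -
  interpret double_walk M Z W q
    using assms(1-5) by (simp add: double_walk_def double_walk_axioms_def)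
  let ?z = "\<lambda>\<omega> k. Z k \<omega>" and ?w = "\<lambda>\<omega> k. W k \<omega>"
  have pos: "min (pmf q 1) (pmf q 2) > 0" using assms(6) by simp
  have ev: "AE \<omega> in M. eventually (\<lambda>n. \<not> avoids a (?z \<omega>) (?w \<omega>) (int n)) sequentially" if a: "a \<le> 0" for a
    using AE_summable_hitp[OF a] AE_eventually_not_avoid_small[OF a pos]
  proof eventually_elim
    case (elim \<omega>)
    then show ?case
      unfolding hitp_def state_def avoid_event_def
      by (intro eventually_not_avoids[OF a pos assms(7)])
  qed
  \<comment> \<open>Only countably many levels are used, so the exceptional null sets can be
    united.\<close>
  have "AE \<omega> in M. \<forall>k. eventually (\<lambda>n. \<not> avoids (- int k) (?z \<omega>) (?w \<omega>) (int n)) sequentially"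
    using ev by (simp add: AE_all_countable)
  with AE_steps_pos show ?thesis
  proof eventually_elim
    case (elim \<omega>)
    show ?case
      unfolding filterlim_at_bot
    proof
      note steps = elim(1)
      fix b :: int
      \<comment> \<open>The level \<open>- int (nat (- b))\<close> is \<open>min b 0\<close>, so it
        is nonpositive and at most \<open>b\<close>.\<close>
      have "eventually (\<lambda>n. \<not> avoids (- int (nat (- b))) (?z \<omega>) (?w \<omega>) (int n)) sequentially"
        using elim(2) by blast
      then show "eventually (\<lambda>n. Lmin (?z \<omega>) (?w \<omega>) (int n) \<le> b) sequentially"
      proof eventually_elim
        case (elim n)
        have "Lmin (?z \<omega>) (?w \<omega>) (int n) \<le> - int (nat (- b))"
          using steps elim by (intro Lmin_le_if_not_avoids) auto
        then show ?case by linarith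
      qed
    qed
  qed
qed

end
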